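(* Let $V_1,\dots,V_r$ be finite-dimensional real vector spaces, let $G_i\subset GL(V_i)$ ($1\le i\le r$) be finite groups, and let $k$ be an integer. If every $G_i$ is generated in codimension $k$, then the product group $G_1\times\dots\times G_r\subset GL(V_1\times\dots\times V_r)$ is generated in codimension $k$. Likewise, if every $G_i$ is strictly generated in codimension $k$, then $G_1\times\dots\times G_r$ is strictly generated in codimension $k$.
   Context: The product $G_1\times\dots\times G_r$ is regarded as a linear group acting factor-wise on $V_1\times\dots\times V_r$. For $g\in GL(V)$, $V^{\langle g\rangle}$ is the subspace of vectors fixed by $g$. A finite group $G\subset GL(V)$ is generated in codimension $k$ if it is generated by its elements $g$ with $\operatorname{codim}V^{\langle g\rangle}\le k$, and strictly generated in codimension $k$ if it is generated by its elements $g$ with $\operatorname{codim}V^{\langle g\rangle}=k$. *)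

theory Defs
  imports
    "HOL-Analysis.Finite_Cartesian_Product"
    "HOL-Algebra.Bij"
    "HOL-Algebra.Generated_Groups"
begin

text \<open>
  So that the spaces $V_1, \dots, V_r$ may have different dimensions, they are modelled as
  finite-dimensional subspaces of one real vector space type \<open>'a\<close>. This loses no generality:
  \<open>'a\<close> is arbitrary, and finitely many spaces always embed into a common one. The index set
  $\{1, \dots, r\}$ is a finite type \<open>'r\<close>, and $V_1 \times \dots \times V_r$ is the corresponding
  subspace of \<open>'a ^ 'r\<close>.
\<close>

definition fin_dim_space :: "'a::real_vector set \<Rightarrow> bool" where
  "fin_dim_space V \<longleftrightarrow> subspace V \<and> (\<exists>B. finite B \<and> span B = V)"

definition linear_map_on :: "'a::real_vector set \<Rightarrow> ('a \<Rightarrow> 'a) \<Rightarrow> bool" where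
  "linear_map_on V g \<longleftrightarrow>
    (\<forall>x\<in>V. \<forall>y\<in>V. g (x + y) = g x + g y) \<and> (\<forall>c. \<forall>x\<in>V. g (c *\<^sub>R x) = c *\<^sub>R g x)"

text \<open>
  As in \<^const>\<open>BijGroup\<close>, the elements are functions on the whole type that are \<^const>\<open>undefined\<close>
  outside \<open>V\<close>, so that distinct elements differ on \<open>V\<close>.
\<close>

definition GL :: "'a::real_vector set \<Rightarrow> ('a \<Rightarrow> 'a) monoid" where
  "GL V = (BijGroup V)\<lparr>carrier := {g \<in> Bij V. linear_map_on V g}\<rparr>"

definition finite_linear_group :: "'a::real_vector set \<Rightarrow> ('a \<Rightarrow> 'a) set \<Rightarrow> bool" where
  "finite_linear_group V G \<longleftrightarrow> finite G \<and> subgroup G (GL V)"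

definition fixed_space :: "'a::real_vector set \<Rightarrow> ('a \<Rightarrow> 'a) \<Rightarrow> 'a set" where
  "fixed_space V g = {x \<in> V. g x = x}"

definition codim_in :: "'a::real_vector set \<Rightarrow> 'a set \<Rightarrow> int" where
  "codim_in V W = int (dim V) - int (dim W)"

definition generated_in_codim :: "'a::real_vector set \<Rightarrow> int \<Rightarrow> ('a \<Rightarrow> 'a) set \<Rightarrow> bool" where
  "generated_in_codim V k G \<longleftrightarrow>
    generate (GL V) {g \<in> G. codim_in V (fixed_space V g) \<le> k} = G"

definition strictly_generated_in_codim ::
    "'a::real_vector set \<Rightarrow> int \<Rightarrow> ('a \<Rightarrow> 'a) set \<Rightarrow> bool" where
  "strictly_generated_in_codim V k G \<longleftrightarrow>
    generate (GL V) {g \<in> G. codim_in V (fixed_space V g) = k} = G"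

definition prod_space :: "('r::finite \<Rightarrow> 'a::real_vector set) \<Rightarrow> ('a ^ 'r) set" where
  "prod_space V = {x. \<forall>i. x $ i \<in> V i}"

definition prod_map ::
    "('r::finite \<Rightarrow> 'a::real_vector set) \<Rightarrow> ('r \<Rightarrow> 'a \<Rightarrow> 'a) \<Rightarrow> 'a ^ 'r \<Rightarrow> 'a ^ 'r" where
  "prod_map V g = (\<lambda>x\<in>prod_space V. \<chi> i. g i (x $ i))"

definition prod_group ::
    "('r::finite \<Rightarrow> 'a::real_vector set) \<Rightarrow> ('r \<Rightarrow> ('a \<Rightarrow> 'a) set) \<Rightarrow> ('a ^ 'r \<Rightarrow> 'a ^ 'r) set" where
  "prod_group V G = prod_map V ` {g. \<forall>i. g i \<in> G i}"

lemma group_GL: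
  assumes "subspace V"
  shows "group (GL V)"
proof -
  have "subgroup {g \<in> Bij V. linear_map_on V g} (BijGroup V)"
  proof
    show "{g \<in> Bij V. linear_map_on V g} \<subseteq> carrier (BijGroup V)"
      by (auto simp: BijGroup_def)
  next
    fix f g assume f: "f \<in> {g \<in> Bij V. linear_map_on V g}" and g: "g \<in> {g \<in> Bij V. linear_map_on V g}"
    have "g x \<in> V" if "x \<in> V" for x using g that by (auto simp: Bij_def bij_betw_def)
    then have "linear_map_on V (compose V f g)"
      using f g assms by (auto simp: linear_map_on_def compose_def subspace_add subspace_scale)
    then show "f \<otimes>\<^bsub>BijGroup V\<^esub> g \<in> {g \<in> Bij V. linear_map_on V g}"
      using f g by (auto simp: BijGroup_def compose_Bij)
  next
    show "\<one>\<^bsub>BijGroup V\<^esub> \<in> {g \<in> Bij V. linear_map_on V g}"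
      using assms id_Bij[of V]
      by (auto simp: BijGroup_def linear_map_on_def subspace_add subspace_scale)
  next
    fix f assume f: "f \<in> {g \<in> Bij V. linear_map_on V g}"
    let ?h = "\<lambda>x\<in>V. inv_into V f x"
    have bij: "bij_betw f V V" using f by (auto simp: Bij_def)
    have hV: "?h x \<in> V" and fh: "f (?h x) = x" if "x \<in> V" for x
      using bij that by (auto simp: bij_betw_def inv_into_into f_inv_into_f)
    have uniq: "?h y = x" if "x \<in> V" "f x = y" for x y
      using bij that by (auto simp: bij_betw_def inv_into_f_f)
    have "linear_map_on V ?h"
      unfolding linear_map_on_def
    proof (intro conjI ballI allI)
      fix x y assume xy: "x \<in> V" "y \<in> V"
      then have "f (?h x + ?h y) = x + y"
        using f hV[OF xy(1)] hV[OF xy(2)] fh[OF xy(1)] fh[OF xy(2)]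
        unfolding linear_map_on_def mem_Collect_eq by metis
      then show "?h (x + y) = ?h x + ?h y"
        using hV[OF xy(1)] hV[OF xy(2)] assms by (intro uniq) (auto simp only: subspace_add)
    next
      fix c x assume x: "x \<in> V"
      then have "f (c *\<^sub>R ?h x) = c *\<^sub>R x"
        using f hV[OF x] fh[OF x] unfolding linear_map_on_def mem_Collect_eq by metis
      then show "?h (c *\<^sub>R x) = c *\<^sub>R ?h x"
        using hV[OF x] assms by (intro uniq) (auto simp only: subspace_scale)
    qed
    then show "inv\<^bsub>BijGroup V\<^esub> f \<in> {g \<in> Bij V. linear_map_on V g}"
      using f restrict_inv_into_Bij[of f V] by (auto simp: inv_BijGroup)
  qed
  then show ?thesis
    unfolding GL_def by (rule subgroup.subgroup_is_group) (rule group_BijGroup)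
qed

lemma fin_dim_space_prod:
  assumes "\<And>i. fin_dim_space (V i)"
  shows "fin_dim_space (prod_space V)"
proof -
  have sub: "subspace (prod_space V)"
    using assms by (auto simp: prod_space_def fin_dim_space_def subspace_def)
  obtain B where B: "\<And>i. finite (B i)" "\<And>i. span (B i) = V i"
    using assms unfolding fin_dim_space_def by metis
  let ?C = "\<Union>i. axis i ` B i"
  have lin: "linear (axis i :: 'b \<Rightarrow> 'b ^ 'a)" for i
    by (rule linearI) (simp_all add: axis_def vec_eq_iff)
  have "?C \<subseteq> prod_space V"
    using assms B(2) span_base unfolding fin_dim_space_def prod_space_def axis_def subspace_def
    by fastforce
  then have "span ?C \<subseteq> prod_space V"
    using sub by (rule span_minimal)
  moreover have "x \<in> span ?C" if "x \<in> prod_space V" for x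
  proof -
    have "axis i (x $ i) \<in> span ?C" for i
    proof -
      have "axis i (x $ i) \<in> axis i ` span (B i)"
        using that B(2) by (auto simp: prod_space_def)
      also have "\<dots> = span (axis i ` B i)"
        by (rule linear_span_image[OF lin, symmetric])
      also have "\<dots> \<subseteq> span ?C" by (rule span_mono) auto
      finally show ?thesis .
    qed
    then have "(\<Sum>i\<in>UNIV. axis i (x $ i)) \<in> span ?C" by (intro span_sum)
    moreover have "(\<Sum>i\<in>UNIV. axis i (x $ i)) = x"
      by (simp add: vec_eq_iff axis_def)
    ultimately show ?thesis by simp
  qed
  ultimately have "span ?C = prod_space V" by blast
  moreover have "finite ?C" using B(1) by auto
  ultimately show ?thesis using sub unfolding fin_dim_space_def by blast
qed

lemma finite_linear_group_prod:
  assumes V: "\<And>i. fin_dim_space (V i)" and G: "\<And>i. finite_linear_group (V i) (G i)"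
  shows "finite_linear_group (prod_space V) (prod_group V G)"
proof -
  have sub: "subspace (V i)" for i using V by (simp add: fin_dim_space_def)
  have subP: "subspace (prod_space V)" using fin_dim_space_prod[of V, OF V] by (simp add: fin_dim_space_def)
  interpret P: group "GL (prod_space V)" by (rule group_GL[OF subP])
  have grp: "group (GL (V i))" for i by (rule group_GL[OF sub])
  have sg: "subgroup (G i) (GL (V i))" for i using G by (simp add: finite_linear_group_def)
  have GB: "g \<in> Bij (V i)" "linear_map_on (V i) g" if "g \<in> G i" for g i
    using subgroup.mem_carrier[OF sg that] by (auto simp: GL_def)
  have mult: "a \<otimes>\<^bsub>GL W\<^esub> b = compose W a b" if "a \<in> Bij W" "b \<in> Bij W"
    for W :: "'c::real_vector set" and a b using that by (auto simp: GL_def BijGroup_def)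
  have one: "\<one>\<^bsub>GL W\<^esub> = (\<lambda>x\<in>W. x)" for W :: "'c::real_vector set"
    by (auto simp: GL_def BijGroup_def)
  have GV: "g x \<in> V i" if "g \<in> G i" "x \<in> V i" for g x i
    using GB(1)[OF that(1)] that(2) by (auto simp: Bij_def bij_betw_def)
  have comp: "compose (prod_space V) (prod_map V g) (prod_map V h) =
      prod_map V (\<lambda>i. g i \<otimes>\<^bsub>GL (V i)\<^esub> h i)" if "\<And>i. g i \<in> G i" "\<And>i. h i \<in> G i" for g h
  proof (rule ext)
    fix x
    show "compose (prod_space V) (prod_map V g) (prod_map V h) x =
        prod_map V (\<lambda>i. g i \<otimes>\<^bsub>GL (V i)\<^esub> h i) x"
    proof (cases "x \<in> prod_space V")
      case True
      then have x: "\<And>i. x $ i \<in> V i" by (simp add: prod_space_def)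
      have "(\<chi> i. h i (x $ i)) \<in> prod_space V"
        using GV[OF that(2) x] by (simp add: prod_space_def)
      moreover have "(g i \<otimes>\<^bsub>GL (V i)\<^esub> h i) (x $ i) = g i (h i (x $ i))" for i
        using mult[OF GB(1)[OF that(1)] GB(1)[OF that(2)], of i] x by (simp add: compose_eq)
      ultimately show ?thesis
        using True by (simp add: prod_map_def compose_eq)
    qed (simp add: prod_map_def compose_def)
  qed
  have id: "prod_map V (\<lambda>i. \<one>\<^bsub>GL (V i)\<^esub>) = (\<lambda>x\<in>prod_space V. x)"
    by (auto simp: prod_map_def one fun_eq_iff prod_space_def vec_eq_iff)
  let ?I = "\<lambda>g i. inv\<^bsub>GL (V i)\<^esub> (g i)"
  have IG: "\<And>i. ?I g i \<in> G i" if "\<And>i. g i \<in> G i" for g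
    using subgroup.m_inv_closed[OF sg that] .
  have maps: "prod_map V g x \<in> prod_space V" if "\<And>i. g i \<in> G i" "x \<in> prod_space V" for g x
    using that by (auto simp: prod_map_def prod_space_def GV)
  have left: "compose (prod_space V) (prod_map V (?I g)) (prod_map V g) = (\<lambda>x\<in>prod_space V. x)"
    if g: "\<And>i. g i \<in> G i" for g
    using comp[of "?I g" g, OF IG[of g, OF g] g]
      group.l_inv[OF grp subgroup.mem_carrier[OF sg g]] by (simp add: id)
  have right: "compose (prod_space V) (prod_map V g) (prod_map V (?I g)) = (\<lambda>x\<in>prod_space V. x)"
    if g: "\<And>i. g i \<in> G i" for g
    using comp[of g "?I g", OF g IG[of g, OF g]]
      group.r_inv[OF grp subgroup.mem_carrier[OF sg g]] by (simp add: id)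
  have carr: "prod_map V g \<in> carrier (GL (prod_space V))" if g: "\<And>i. g i \<in> G i" for g
  proof -
    have "bij_betw (prod_map V g) (prod_space V) (prod_space V)"
    proof (rule bij_betw_byWitness[where f' = "prod_map V (?I g)"])
      show "\<forall>a\<in>prod_space V. prod_map V (?I g) (prod_map V g a) = a"
      proof
        fix a assume "a \<in> prod_space V"
        with fun_cong[OF left[of g, OF g], of a] show "prod_map V (?I g) (prod_map V g a) = a"
          by (simp add: compose_eq)
      qed
      show "\<forall>a\<in>prod_space V. prod_map V g (prod_map V (?I g) a) = a"
      proof
        fix a assume "a \<in> prod_space V"
        with fun_cong[OF right[of g, OF g], of a] show "prod_map V g (prod_map V (?I g) a) = a"
          by (simp add: compose_eq)
      qed
      show "prod_map V g ` prod_space V \<subseteq> prod_space V" using maps[of g] g by blast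
      show "prod_map V (?I g) ` prod_space V \<subseteq> prod_space V"
        using maps[of "?I g"] IG[of g, OF g] by blast
    qed
    moreover have "linear_map_on (prod_space V) (prod_map V g)"
      using GB(2)[OF g] subP
      by (simp add: linear_map_on_def prod_map_def subspace_add subspace_scale vec_eq_iff)
        (simp add: prod_space_def)
    ultimately show ?thesis by (auto simp: GL_def Bij_def prod_map_def)
  qed
  have inP: "prod_map V g \<in> prod_group V G" if "\<And>i. g i \<in> G i" for g
    using that by (auto simp: prod_group_def)
  have "subgroup (prod_group V G) (GL (prod_space V))"
  proof (rule P.subgroupI)
    show "prod_group V G \<subseteq> carrier (GL (prod_space V))"
      using carr by (auto simp: prod_group_def)
    show "prod_group V G \<noteq> {}"
      using inP[of "\<lambda>i. \<one>\<^bsub>GL (V i)\<^esub>", OF subgroup.one_closed[OF sg]] by blast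
  next
    fix a assume "a \<in> prod_group V G"
    then obtain g where g: "\<And>i. g i \<in> G i" and a: "a = prod_map V g"
      by (auto simp: prod_group_def)
    have "prod_map V (?I g) \<otimes>\<^bsub>GL (prod_space V)\<^esub> a = \<one>\<^bsub>GL (prod_space V)\<^esub>"
      using carr[OF g] carr[OF IG[of g, OF g]] left[OF g]
      by (simp add: a one mult GL_def BijGroup_def)
    then have "inv\<^bsub>GL (prod_space V)\<^esub> a = prod_map V (?I g)"
      using carr[of g, OF g] carr[of "?I g", OF IG[of g, OF g]] a P.inv_equality by blast
    then show "inv\<^bsub>GL (prod_space V)\<^esub> a \<in> prod_group V G"
      using inP[of "?I g", OF IG[of g, OF g]] by simp
  next
    fix a b assume "a \<in> prod_group V G" "b \<in> prod_group V G"
    then obtain g h where g: "\<And>i. g i \<in> G i" and a: "a = prod_map V g"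
      and h: "\<And>i. h i \<in> G i" and b: "b = prod_map V h"
      by (auto simp: prod_group_def)
    have "a \<otimes>\<^bsub>GL (prod_space V)\<^esub> b = prod_map V (\<lambda>i. g i \<otimes>\<^bsub>GL (V i)\<^esub> h i)"
      using carr[OF g] carr[OF h] comp[OF g h] by (simp add: a b GL_def BijGroup_def)
    then show "a \<otimes>\<^bsub>GL (prod_space V)\<^esub> b \<in> prod_group V G"
      using inP[of "\<lambda>i. g i \<otimes>\<^bsub>GL (V i)\<^esub> h i", OF subgroup.m_closed[OF sg g h]] by simp
  qed
  moreover have "finite (prod_group V G)"
  proof -
    have "finite (PiE UNIV G)"
      using G by (intro finite_PiE) (auto simp: finite_linear_group_def)
    moreover have "{g. \<forall>i. g i \<in> G i} = PiE UNIV G" by (auto simp: PiE_UNIV_domain)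
    ultimately show ?thesis by (simp add: prod_group_def)
  qed
  ultimately show ?thesis by (simp add: finite_linear_group_def)
qed

end

theory Submission
  imports Defs
begin

text \<open>
  Embed each factor as \<open>g \<mapsto> (1, \<dots>, g, \<dots>, 1)\<close>. This is a group homomorphism that preserves the
  codimension of the fixed space, because dimensions add up over products; hence the subgroup
  generated by the admissible elements of the product contains every embedded factor, and the
  embedded factors generate the product.
\<close>

section \<open>Dimension of a product of subspaces\<close>

text \<open>A maximal independent subset of \<open>W\<close> lies in the span of a finite set
  spanning \<open>V\<close>, so the exchange bound makes it finite.\<close>

lemma fin_dim_space_basis:
  assumes "fin_dim_space V" "subspace W" "W \<subseteq> V"
  obtains B where "finite B" "independent B" "span B = W"
proof -
  obtain C where C: "finite C" "span C = V" using assms(1) by (auto simp: fin_dim_space_def)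
  obtain B where B: "B \<subseteq> W" "independent B" "W \<subseteq> span B"
    by (metis maximal_independent_subset)
  have "finite B" using C B assms(3) independent_span_bound[of C B] by blast
  moreover have "span B = W" using B span_minimal[OF B(1) assms(2)] by blast
  ultimately show ?thesis using that B(2) by blast
qed

text \<open>Bases of the factors, pushed along the coordinate axes, together form a basis of the
  product; counting it gives the sum.\<close>

lemma dim_prod_space:
  fixes W :: "'r::finite \<Rightarrow> 'a::real_vector set"
  assumes "\<And>i. fin_dim_space (W i)"
  shows "dim (prod_space W) = (\<Sum>i\<in>UNIV. dim (W i))"
proof -
  have sub: "subspace (W i)" for i using assms by (simp add: fin_dim_space_def)
  have "\<exists>B. finite B \<and> independent B \<and> span B = W i" for i
    by (rule fin_dim_space_basis[OF assms sub subset_refl]) blast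
  then obtain B where fin: "\<And>i. finite (B i)" and ind: "\<And>i. independent (B i)"
    and spanB: "\<And>i. span (B i) = W i" by metis
  let ?C = "\<Union>i. axis i ` B i"
  \<comment> \<open>Images under different axes can meet only in 0, so this makes them disjoint when
    \<open>?C\<close> is counted below.\<close>
  have nz: "0 \<notin> B i" for i using ind dependent_zero by blast
  have lin: "linear (axis i :: 'a \<Rightarrow> 'a ^ 'r)" for i
    by (rule linearI) (simp_all add: axis_def vec_eq_iff)
  have inj: "inj_on (axis i :: 'a \<Rightarrow> 'a ^ 'r) A" for i A
    by (auto simp: inj_on_def axis_eq_axis)
  have finC: "finite ?C" using fin by auto
  have indC: "independent ?C"
  proof (rule independent_if_scalars_zero[OF finC])
    fix f x assume sum0: "(\<Sum>x\<in>?C. f x *\<^sub>R x) = 0" and "x \<in> ?C"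
    then obtain i b where x: "x = axis i b" and b: "b \<in> B i" by auto
    \<comment> \<open>Coordinate \<open>i\<close> of the vanishing combination kills the vectors on
      all other axes, which leaves a relation within the independent set \<open>B i\<close>.\<close>
    have "0 = (\<Sum>x\<in>?C. f x *\<^sub>R x) $ i" using sum0 by simp
    also have "\<dots> = (\<Sum>x\<in>?C. f x *\<^sub>R x $ i)" by (simp add: sum_component)
    also have "\<dots> = (\<Sum>x\<in>axis i ` B i. f x *\<^sub>R x $ i)"
    proof (rule sum.mono_neutral_right[OF finC])
      show "\<forall>y\<in>?C - axis i ` B i. f y *\<^sub>R y $ i = 0"
      proof
        fix y assume "y \<in> ?C - axis i ` B i"
        then obtain j c where y: "y = axis j c" and "c \<in> B j" "y \<notin> axis i ` B i" by blast
        then have "j \<noteq> i" by blast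
        with y show "f y *\<^sub>R y $ i = 0" by (simp add: axis_def)
      qed
    qed blast
    also have "\<dots> = (\<Sum>c\<in>B i. f (axis i c) *\<^sub>R c)"
      by (subst sum.reindex[OF inj]) (simp add: axis_def)
    finally show "f x = 0"
      using independentD[OF ind fin subset_refl _ b, of "\<lambda>c. f (axis i c)"] x by simp
  qed
  have "span ?C = prod_space W"
  proof
    have "?C \<subseteq> prod_space W"
    proof
      fix x assume "x \<in> ?C"
      then obtain i b where x: "x = axis i b" and "b \<in> B i" by auto
      then have "b \<in> W i" using span_base[of b "B i"] spanB by simp
      then show "x \<in> prod_space W"
        using subspace_0[OF sub] by (simp add: x prod_space_def axis_def)
    qed
    then show "span ?C \<subseteq> prod_space W"
      using fin_dim_space_prod[of W, OF assms]
      by (intro span_minimal) (auto simp: fin_dim_space_def)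
  next
    show "prod_space W \<subseteq> span ?C"
    proof
      fix x assume x: "x \<in> prod_space W"
      have "axis i (x $ i) \<in> span ?C" for i
      proof -
        have "axis i (x $ i) \<in> span (axis i ` B i)"
          using x spanB by (auto simp: prod_space_def linear_span_image[OF lin])
        then show ?thesis by (rule set_mp[OF span_mono, rotated]) auto
      qed
      then have "(\<Sum>i\<in>UNIV. axis i (x $ i)) \<in> span ?C" by (intro span_sum)
      moreover have "(\<Sum>i\<in>UNIV. axis i (x $ i)) = x" by (simp add: vec_eq_iff axis_def)
      ultimately show "x \<in> span ?C" by simp
    qed
  qed
  then have "dim (prod_space W) = card ?C"
    using dim_span_eq_card_independent[OF indC] by simp
  also have "\<dots> = (\<Sum>i\<in>UNIV. card (axis i ` B i :: ('a ^ 'r) set))"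
    by (rule card_UN_disjoint) (use fin nz in \<open>auto simp: axis_eq_axis\<close>)
  also have "\<dots> = (\<Sum>i\<in>UNIV. dim (W i))"
    using dim_span_eq_card_independent[OF ind] by (simp add: card_image[OF inj] spanB)
  finally show ?thesis .
qed

section \<open>Product maps inside the general linear group\<close>

lemma GL_one: "\<one>\<^bsub>GL W\<^esub> = (\<lambda>x\<in>W. x)"
  by (simp add: GL_def BijGroup_def)

lemma GL_mult:
  "f \<in> carrier (GL W) \<Longrightarrow> g \<in> carrier (GL W) \<Longrightarrow> f \<otimes>\<^bsub>GL W\<^esub> g = compose W f g"
  by (simp add: GL_def BijGroup_def)

lemma GL_maps: "g \<in> carrier (GL W) \<Longrightarrow> x \<in> W \<Longrightarrow> g x \<in> W"
  by (auto simp: GL_def Bij_def bij_betw_def)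

text \<open>\<open>linear_map_on\<close> says nothing about 0; that \<open>g\<close> fixes it is
  homogeneity with scalar 0.\<close>

lemma subspace_fixed_space:
  assumes "subspace W" "linear_map_on W g"
  shows "subspace (fixed_space W g)"
  using assms subspace_0[of W] unfolding linear_map_on_def
  by (auto simp: fixed_space_def subspace_def) (metis scaleR_zero_left)

text \<open>The entries range over the full groups \<open>GL (V i)\<close>, since the embedding of a
  factor is to be a homomorphism on all of \<open>GL (V i)\<close>.\<close>

lemma prod_map_in_GL:
  assumes V: "\<And>i. subspace (V i)" and g: "\<And>i. g i \<in> carrier (GL (V i))"
  shows "prod_map V g \<in> carrier (GL (prod_space V))"
proof -
  have bij: "bij_betw (g i) (V i) (V i)" and lin: "linear_map_on (V i) (g i)" for i
    using g[of i] by (auto simp: GL_def Bij_def)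
  have subP: "subspace (prod_space V)"
    using V by (auto simp: prod_space_def subspace_def)
  have "bij_betw (prod_map V g) (prod_space V) (prod_space V)"
  proof (rule bij_betwI')
    fix x y assume "x \<in> prod_space V" "y \<in> prod_space V"
    then show "prod_map V g x = prod_map V g y \<longleftrightarrow> x = y"
      using inj_on_eq_iff[OF bij_betw_imp_inj_on[OF bij]]
      by (simp add: prod_map_def vec_eq_iff) (simp add: prod_space_def)
  next
    fix x assume "x \<in> prod_space V"
    then show "prod_map V g x \<in> prod_space V"
      using GL_maps[OF g] by (simp add: prod_map_def prod_space_def)
  next
    fix y assume "y \<in> prod_space V"
    then have "y $ i \<in> g i ` V i" for i
      using bij_betw_imp_surj_on[OF bij] by (simp add: prod_space_def)
    then have "\<forall>i. \<exists>z\<in>V i. y $ i = g i z" by blast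
    then obtain z where z: "\<And>i. z i \<in> V i" "\<And>i. y $ i = g i (z i)" by metis
    then have "vec_lambda z \<in> prod_space V" "y = prod_map V g (vec_lambda z)"
      by (auto simp: prod_space_def prod_map_def vec_eq_iff)
    then show "\<exists>x\<in>prod_space V. y = prod_map V g x" by blast
  qed
  moreover have "linear_map_on (prod_space V) (prod_map V g)"
    \<comment> \<open>\<open>prod_space\<close> first stays folded, so that its closure under sums
      and multiples applies; only then is it unfolded to use the linearity of each
      \<open>g i\<close>.\<close>
    using lin subP
    by (simp add: linear_map_on_def prod_map_def subspace_add subspace_scale vec_eq_iff)
      (simp add: prod_space_def)
  ultimately show ?thesis by (auto simp: GL_def Bij_def prod_map_def)
qed

lemma prod_map_mult:
  assumes V: "\<And>i. subspace (V i)"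
    and g: "\<And>i. g i \<in> carrier (GL (V i))" and h: "\<And>i. h i \<in> carrier (GL (V i))"
  shows "prod_map V g \<otimes>\<^bsub>GL (prod_space V)\<^esub> prod_map V h =
    prod_map V (\<lambda>i. g i \<otimes>\<^bsub>GL (V i)\<^esub> h i)"
proof -
  have "(\<chi> i. h i (x $ i)) \<in> prod_space V" if "x \<in> prod_space V" for x
    using that GL_maps[OF h] by (simp add: prod_space_def)
  moreover have "(g i \<otimes>\<^bsub>GL (V i)\<^esub> h i) (x $ i) = g i (h i (x $ i))" if "x \<in> prod_space V" for x i
    using that by (simp add: GL_mult[OF g h] compose_eq prod_space_def)
  ultimately show ?thesis
    unfolding GL_mult[OF prod_map_in_GL[of V g, OF V g] prod_map_in_GL[of V h, OF V h]]
    by (auto simp: prod_map_def compose_def fun_eq_iff)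
qed

section \<open>Embedded factors and their codimension\<close>

text \<open>The idle entries are the units of \<open>GL (V j)\<close>, that is, identities
  restricted to \<open>V j\<close>, so that every entry lies in its carrier as
  \<open>prod_map_mult\<close> requires.\<close>

definition factor_map ::
    "('r::finite \<Rightarrow> 'a::real_vector set) \<Rightarrow> 'r \<Rightarrow> ('a \<Rightarrow> 'a) \<Rightarrow> 'a ^ 'r \<Rightarrow> 'a ^ 'r" where
  "factor_map V i g = prod_map V ((\<lambda>j. \<one>\<^bsub>GL (V j)\<^esub>)(i := g))"

text \<open>The domain is \<open>GL (V i)\<close> because \<open>generate\<close> is taken there;
  the homomorphism then carries generated subgroups to generated subgroups.\<close>

lemma factor_map_hom:
  assumes V: "\<And>i. subspace (V i)"
  shows "group_hom (GL (V i)) (GL (prod_space V)) (factor_map V i)"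
proof -
  have grp: "group (GL (V j))" for j by (rule group_GL[OF V])
  have subP: "subspace (prod_space V)"
    using V by (auto simp: prod_space_def subspace_def)
  have one: "\<one>\<^bsub>GL (V j)\<^esub> \<in> carrier (GL (V j))" for j
    using grp by (simp add: group.is_monoid monoid.one_closed)
  have "factor_map V i \<in> hom (GL (V i)) (GL (prod_space V))"
  proof (rule homI)
    fix g assume "g \<in> carrier (GL (V i))"
    then show "factor_map V i g \<in> carrier (GL (prod_space V))"
      unfolding factor_map_def using V one by (intro prod_map_in_GL) auto
  next
    fix g h assume gh: "g \<in> carrier (GL (V i))" "h \<in> carrier (GL (V i))"
    have "factor_map V i g \<otimes>\<^bsub>GL (prod_space V)\<^esub> factor_map V i h =
      prod_map V (\<lambda>j. ((\<lambda>j. \<one>\<^bsub>GL (V j)\<^esub>)(i := g)) j \<otimes>\<^bsub>GL (V j)\<^esub> ((\<lambda>j. \<one>\<^bsub>GL (V j)\<^esub>)(i := h)) j)"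
      unfolding factor_map_def using V one gh by (intro prod_map_mult) auto
    also have "(\<lambda>j. ((\<lambda>j. \<one>\<^bsub>GL (V j)\<^esub>)(i := g)) j \<otimes>\<^bsub>GL (V j)\<^esub> ((\<lambda>j. \<one>\<^bsub>GL (V j)\<^esub>)(i := h)) j)
        = (\<lambda>j. \<one>\<^bsub>GL (V j)\<^esub>)(i := g \<otimes>\<^bsub>GL (V i)\<^esub> h)"
      using grp one by (auto simp: fun_eq_iff group.is_monoid monoid.l_one)
    finally show "factor_map V i (g \<otimes>\<^bsub>GL (V i)\<^esub> h) =
        factor_map V i g \<otimes>\<^bsub>GL (prod_space V)\<^esub> factor_map V i h"
      unfolding factor_map_def by (rule sym)
  qed
  then show ?thesis
    using grp group_GL[OF subP] by (simp add: group_hom_def group_hom_axioms_def)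
qed

text \<open>The fixed space of the embedded map is the product in which only the factor
  \<open>V i\<close> is replaced by the fixed space of \<open>g\<close>. Dimensions add, and the
  terms of all other indices cancel in the difference.\<close>

lemma codim_factor_map:
  assumes V: "\<And>i. fin_dim_space (V i)" and g: "g \<in> carrier (GL (V i))"
  shows "codim_in (prod_space V) (fixed_space (prod_space V) (factor_map V i g)) =
    codim_in (V i) (fixed_space (V i) g)"
proof -
  let ?F = "fixed_space (V i) g"
  \<comment> \<open>Additivity of dimension for \<open>V(i := ?F)\<close> requires the new factor to
    be finite-dimensional too.\<close>
  have F: "fin_dim_space ?F"
  proof -
    have sub: "subspace ?F"
      using V[of i] g by (intro subspace_fixed_space) (auto simp: fin_dim_space_def GL_def)
    have "?F \<subseteq> V i" by (auto simp: fixed_space_def)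
    from fin_dim_space_basis[OF V sub this] sub show ?thesis
      unfolding fin_dim_space_def by blast
  qed
  have "fixed_space (prod_space V) (factor_map V i g) = prod_space (V(i := ?F))"
    by (auto simp: fixed_space_def factor_map_def prod_map_def prod_space_def vec_eq_iff GL_one
        split: if_splits)
  moreover have "dim (prod_space (V(i := ?F))) = (\<Sum>j\<in>UNIV. dim ((V(i := ?F)) j))"
    using V F by (intro dim_prod_space) auto
  ultimately show ?thesis
    using dim_prod_space[of V, OF V]
    by (simp add: codim_in_def sum.remove[where A = UNIV and x = i])
qed

section \<open>Generation of the product group\<close>

text \<open>The embeddings preserve the codimension exactly, so any condition \<open>Q\<close> on it
  passes to the product. Taking \<open>Q\<close> as "at most \<open>k\<close>" and as "equal to
  \<open>k\<close>" covers both claims at once.\<close>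

lemma prod_group_generated:
  assumes V: "\<And>i. fin_dim_space (V i)" and G: "\<And>i. finite_linear_group (V i) (G i)"
    and gen: "\<And>i. generate (GL (V i)) {g \<in> G i. Q (codim_in (V i) (fixed_space (V i) g))} = G i"
  shows "generate (GL (prod_space V))
    {g \<in> prod_group V G. Q (codim_in (prod_space V) (fixed_space (prod_space V) g))} =
    prod_group V G"
    (is "generate ?P ?S = _")
proof
  have sub: "subspace (V i)" for i using V by (simp add: fin_dim_space_def)
  have sg: "subgroup (G i) (GL (V i))" for i using G by (simp add: finite_linear_group_def)
  have carr: "g \<in> carrier (GL (V i))" if "g \<in> G i" for g i
    by (rule subgroup.mem_carrier[OF sg that])
  have sgP: "subgroup (prod_group V G) ?P"
    using finite_linear_group_prod[of V G, OF V G] by (simp add: finite_linear_group_def)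
  have grpP: "group ?P"
    using fin_dim_space_prod[of V, OF V] by (intro group_GL) (simp add: fin_dim_space_def)
  show "generate ?P ?S \<subseteq> prod_group V G"
    by (rule group.generate_subgroup_incl[OF grpP _ sgP]) auto
  have S: "?S \<subseteq> carrier ?P" using subgroup.subset[OF sgP] by blast
  have sgS: "subgroup (generate ?P ?S) ?P" by (rule group.generate_is_subgroup[OF grpP S])
  have factor: "factor_map V i g \<in> generate ?P ?S" if g: "g \<in> G i" for i g
  proof -
    let ?T = "{g \<in> G i. Q (codim_in (V i) (fixed_space (V i) g))}"
    have "factor_map V i ` ?T \<subseteq> ?S"
    proof
      fix h assume "h \<in> factor_map V i ` ?T"
      then obtain t where t: "t \<in> G i" "Q (codim_in (V i) (fixed_space (V i) t))"
        and h: "h = factor_map V i t" by auto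
      have "h \<in> prod_group V G"
        unfolding h factor_map_def prod_group_def
        using t(1) subgroup.one_closed[OF sg] by (intro imageI) auto
      then show "h \<in> ?S" using codim_factor_map[of V t i, OF V carr[OF t(1)]] t(2) h by simp
    qed
    then have "generate ?P (factor_map V i ` ?T) \<subseteq> generate ?P ?S"
      by (rule group.mono_generate[OF grpP])
    moreover have "?T \<subseteq> carrier (GL (V i))" using carr by blast
    then have "generate ?P (factor_map V i ` ?T) = factor_map V i ` generate (GL (V i)) ?T"
      by (rule group_hom.generate_img[OF factor_map_hom[of V i, OF sub]])
    \<comment> \<open>By \<open>gen\<close>, the image of the subgroup generated by
      \<open>?T\<close> is the image of all of \<open>G i\<close>.\<close>
    ultimately have "factor_map V i ` G i \<subseteq> generate ?P ?S" by (simp only: gen)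
    then show ?thesis using g by blast
  qed
  show "prod_group V G \<subseteq> generate ?P ?S"
  proof
    fix a assume "a \<in> prod_group V G"
    then obtain g where g: "\<And>i. g i \<in> G i" and a: "a = prod_map V g"
      by (auto simp: prod_group_def)
    have one: "\<one>\<^bsub>GL (V j)\<^esub> \<in> carrier (GL (V j))" for j
      by (rule carr[OF subgroup.one_closed[OF sg]])
    \<comment> \<open>\<open>?m A\<close> keeps the entries of \<open>g\<close> with index in
      \<open>A\<close> and resets the others to units. Induction on \<open>A\<close> multiplies in
      one embedded factor at a time, and \<open>A = UNIV\<close> gives back
      \<open>g\<close>.\<close>
    let ?m = "\<lambda>A j. if j \<in> A then g j else \<one>\<^bsub>GL (V j)\<^esub>"
    have "prod_map V (?m A) \<in> generate ?P ?S" if "finite A" for A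
      using that
    proof (induction A)
      case empty
      have "prod_map V (?m {}) = \<one>\<^bsub>?P\<^esub>"
        by (auto simp: prod_map_def GL_one fun_eq_iff prod_space_def vec_eq_iff)
      then show ?case using subgroup.one_closed[OF sgS] by simp
    next
      case (insert i A)
      have "factor_map V i (g i) \<otimes>\<^bsub>?P\<^esub> prod_map V (?m A) =
        prod_map V (\<lambda>j. ((\<lambda>j. \<one>\<^bsub>GL (V j)\<^esub>)(i := g i)) j \<otimes>\<^bsub>GL (V j)\<^esub> ?m A j)"
        unfolding factor_map_def using sub one carr[OF g] by (intro prod_map_mult) auto
      \<comment> \<open>At index \<open>i\<close> the right-hand entry is a unit because
        \<open>i\<close> is not in \<open>A\<close>; at every other index the left-hand entry is
        one.\<close>
      also have "(\<lambda>j. ((\<lambda>j. \<one>\<^bsub>GL (V j)\<^esub>)(i := g i)) j \<otimes>\<^bsub>GL (V j)\<^esub> ?m A j) = ?m (insert i A)"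
        using insert(2) one carr[OF g] group_GL[OF sub]
        by (auto simp: fun_eq_iff group.is_monoid monoid.l_one monoid.r_one)
      finally show ?case
        using subgroup.m_closed[OF sgS factor[of "g i" i, OF g] insert.IH] by (simp only:)
    qed
    from this[of UNIV] show "a \<in> generate ?P ?S" by (simp add: a)
  qed
qed

theorem proposition2p8:
  fixes V :: "'r::finite \<Rightarrow> 'a::real_vector set"
    and G :: "'r \<Rightarrow> ('a \<Rightarrow> 'a) set"
    and k :: int
  assumes "\<And>i. fin_dim_space (V i)"
    and "\<And>i. finite_linear_group (V i) (G i)"
  shows "((\<forall>i. generated_in_codim (V i) k (G i)) \<longrightarrow>
            generated_in_codim (prod_space V) k (prod_group V G)) \<and>
         ((\<forall>i. strictly_generated_in_codim (V i) k (G i)) \<longrightarrow>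
            strictly_generated_in_codim (prod_space V) k (prod_group V G))"
  using prod_group_generated[of V G "\<lambda>c. c \<le> k", OF assms]
    prod_group_generated[of V G "\<lambda>c. c = k", OF assms]
  unfolding generated_in_codim_def strictly_generated_in_codim_def by blast

end
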